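(* Let $p$ be a prime number and $m\ge 1$ an integer. Let $G(p^m)$ be the ring of polyfunctions over $\mathbb{Z}_{p^m}$ and let $$I_{p,m}=\{f\in\mathbb{Z}_{p^m}[x] : f(kp)=0 \text{ for all } k\in\mathbb{Z}\}.$$ Then: (i) $G(p^m)$ is isomorphic, as a ring, to the direct sum $\bigoplus_{i=1}^{p}\mathbb{Z}_{p^m}[x]/I_{p,m}$ of $p$ copies of $\mathbb{Z}_{p^m}[x]/I_{p,m}$; (ii) the ring $\mathbb{Z}_{p^m}[x]/I_{p,m}$ is not decomposable.
   Context: $\mathbb{Z}_n=\mathbb{Z}/n\mathbb{Z}$. The ring of polyfunctions over a commutative ring $R$ with unit element is the ring of functions $f:R\to R$ for which there is a polynomial $q\in R[x]$ with $f(x)=q(x)$ for all $x\in R$, with pointwise addition and multiplication. $I_{p,m}$ is an ideal of $\mathbb{Z}_{p^m}[x]$. A ring is decomposable if it is isomorphic to a direct sum of two nonzero rings. *)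

theory Defs
  imports "HOL-Number_Theory.Residues" "HOL-Algebra.UnivPoly" "HOL-Algebra.Chinese_Remainder"
begin

text \<open>Functions on the ring are represented extensionally, so that two of them are equal
  iff they agree on the carrier.\<close>

definition polyfun_ring :: "('a, 'm) ring_scheme \<Rightarrow> ('a \<Rightarrow> 'a) ring"
  where "polyfun_ring R =
    \<lparr>carrier = {f \<in> carrier R \<rightarrow>\<^sub>E carrier R.
        \<exists>q \<in> carrier (UP R). \<forall>x \<in> carrier R. f x = eval R R id x q},
     monoid.mult = (\<lambda>f g. \<lambda>x\<in>carrier R. f x \<otimes>\<^bsub>R\<^esub> g x),
     one = (\<lambda>x\<in>carrier R. \<one>\<^bsub>R\<^esub>),
     zero = (\<lambda>x\<in>carrier R. \<zero>\<^bsub>R\<^esub>),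
     add = (\<lambda>f g. \<lambda>x\<in>carrier R. f x \<oplus>\<^bsub>R\<^esub> g x)\<rparr>"

lemma eval_id_hom:
  assumes "cring R" "x \<in> carrier R"
  shows "eval R R id x \<in> ring_hom (UP R) R"
proof -
  interpret R: cring R by fact
  interpret UP_pre_univ_prop R R id "UP R"
    by unfold_locales (auto simp: ring_hom_def)
  show ?thesis using assms(2) by (rule eval_ring_hom)
qed

lemma UP_is_cring: "cring R \<Longrightarrow> cring (UP R)"
  by (simp add: UP_cring.UP_cring UP_cring_def)

lemma polyfun_ring_is_cring:
  assumes "cring R"
  shows "cring (polyfun_ring R)"
proof -
  interpret R: cring R by fact
  interpret P: cring "UP R" using assms by (rule UP_is_cring)
  note hom = eval_id_hom[OF assms]
  note ev = ring_hom_add[OF hom] ring_hom_mult[OF hom] ring_hom_one[OF hom]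
    ring_hom_zero[OF hom P.ring_axioms R.ring_axioms] ring_hom_closed[OF hom]
  let ?F = "polyfun_ring R"
  have memI: "f \<in> carrier ?F"
    if "f \<in> extensional (carrier R)" "q \<in> carrier (UP R)"
      "\<And>x. x \<in> carrier R \<Longrightarrow> f x = eval R R id x q" for f q
    using that by (auto simp: polyfun_ring_def PiE_iff ev)
  have memE: "\<exists>q \<in> carrier (UP R). \<forall>x \<in> carrier R. f x = eval R R id x q" if "f \<in> carrier ?F" for f
    using that by (simp add: polyfun_ring_def)
  have val: "f x \<in> carrier R" if "f \<in> carrier ?F" "x \<in> carrier R" for f x
    using that by (auto simp: polyfun_ring_def)
  have eqI: "f = g" if "f \<in> carrier ?F" "g \<in> carrier ?F" "\<And>x. x \<in> carrier R \<Longrightarrow> f x = g x" for f g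
    using that by (auto simp: polyfun_ring_def intro: PiE_ext)
  have ops: "(f \<otimes>\<^bsub>?F\<^esub> g) x = f x \<otimes>\<^bsub>R\<^esub> g x" "(f \<oplus>\<^bsub>?F\<^esub> g) x = f x \<oplus>\<^bsub>R\<^esub> g x"
    "\<one>\<^bsub>?F\<^esub> x = \<one>\<^bsub>R\<^esub>" "\<zero>\<^bsub>?F\<^esub> x = \<zero>\<^bsub>R\<^esub>" if "x \<in> carrier R" for f g x
    using that by (simp_all add: polyfun_ring_def)
  have ext: "f \<otimes>\<^bsub>?F\<^esub> g \<in> extensional (carrier R)" "f \<oplus>\<^bsub>?F\<^esub> g \<in> extensional (carrier R)"
    "\<one>\<^bsub>?F\<^esub> \<in> extensional (carrier R)" "\<zero>\<^bsub>?F\<^esub> \<in> extensional (carrier R)" for f g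
    by (simp_all add: polyfun_ring_def)
  have one: "\<one>\<^bsub>?F\<^esub> \<in> carrier ?F" and zero: "\<zero>\<^bsub>?F\<^esub> \<in> carrier ?F"
    by (rule memI[OF ext(3) P.one_closed], simp add: ops ev)
      (rule memI[OF ext(4) P.zero_closed], simp add: ops ev)
  have mult: "f \<otimes>\<^bsub>?F\<^esub> g \<in> carrier ?F" and add: "f \<oplus>\<^bsub>?F\<^esub> g \<in> carrier ?F"
    if fg: "f \<in> carrier ?F" "g \<in> carrier ?F" for f g
  proof -
    from memE[OF fg(1)] obtain q
      where q: "q \<in> carrier (UP R)" "\<forall>x \<in> carrier R. f x = eval R R id x q" by blast
    from memE[OF fg(2)] obtain r
      where r: "r \<in> carrier (UP R)" "\<forall>x \<in> carrier R. g x = eval R R id x r" by blast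
    show "f \<otimes>\<^bsub>?F\<^esub> g \<in> carrier ?F"
      by (rule memI[OF ext(1) P.m_closed[OF q(1) r(1)]]) (simp add: ops ev q r)
    show "f \<oplus>\<^bsub>?F\<^esub> g \<in> carrier ?F"
      by (rule memI[OF ext(2) P.a_closed[OF q(1) r(1)]]) (simp add: ops ev q r)
  qed
  have neg: "\<exists>g \<in> carrier ?F. g \<oplus>\<^bsub>?F\<^esub> f = \<zero>\<^bsub>?F\<^esub>" if f: "f \<in> carrier ?F" for f
  proof -
    from memE[OF f] obtain q where q: "q \<in> carrier (UP R)"
      and fq: "\<And>x. x \<in> carrier R \<Longrightarrow> f x = eval R R id x q"
      by blast
    let ?g = "\<lambda>x\<in>carrier R. \<ominus>\<^bsub>R\<^esub> f x"
    have g: "?g \<in> carrier ?F"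
    proof (rule memI)
      show "\<ominus>\<^bsub>UP R\<^esub> q \<in> carrier (UP R)" using q by simp
      fix x assume x: "x \<in> carrier R"
      interpret h: ring_hom_ring "UP R" R "eval R R id x"
        by (rule ring_hom_ringI2[OF P.ring_axioms R.ring_axioms hom[OF x]])
      show "?g x = eval R R id x (\<ominus>\<^bsub>UP R\<^esub> q)" using q x by (simp add: fq)
    qed simp
    moreover have "?g \<oplus>\<^bsub>?F\<^esub> f = \<zero>\<^bsub>?F\<^esub>"
      by (rule eqI) (simp_all add: add zero g f ops val R.l_neg)
    ultimately show ?thesis by blast
  qed
  show ?thesis
  proof (intro cringI abelian_groupI comm_monoidI)
    fix f g h assume "f \<in> carrier ?F" "g \<in> carrier ?F" "h \<in> carrier ?F"
    note c = one zero mult add this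
    show "f \<oplus>\<^bsub>?F\<^esub> g \<oplus>\<^bsub>?F\<^esub> h = f \<oplus>\<^bsub>?F\<^esub> (g \<oplus>\<^bsub>?F\<^esub> h)"
      by (rule eqI) (simp_all add: c ops val R.a_assoc)
    show "f \<otimes>\<^bsub>?F\<^esub> g \<otimes>\<^bsub>?F\<^esub> h = f \<otimes>\<^bsub>?F\<^esub> (g \<otimes>\<^bsub>?F\<^esub> h)"
      by (rule eqI) (simp_all add: c ops val R.m_assoc)
    show "f \<oplus>\<^bsub>?F\<^esub> g = g \<oplus>\<^bsub>?F\<^esub> f"
      by (rule eqI) (simp_all add: c ops val R.a_comm)
    show "f \<otimes>\<^bsub>?F\<^esub> g = g \<otimes>\<^bsub>?F\<^esub> f"
      by (rule eqI) (simp_all add: c ops val R.m_comm)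
    show "(f \<oplus>\<^bsub>?F\<^esub> g) \<otimes>\<^bsub>?F\<^esub> h = f \<otimes>\<^bsub>?F\<^esub> h \<oplus>\<^bsub>?F\<^esub> g \<otimes>\<^bsub>?F\<^esub> h"
      by (rule eqI) (simp_all add: c ops val R.l_distr)
    show "\<zero>\<^bsub>?F\<^esub> \<oplus>\<^bsub>?F\<^esub> f = f" "\<one>\<^bsub>?F\<^esub> \<otimes>\<^bsub>?F\<^esub> f = f"
      by (rule eqI; simp add: c ops val)+
  qed (simp_all add: one zero mult add neg)
qed

abbreviation Zmod :: "nat \<Rightarrow> int ring"
  where "Zmod n \<equiv> residue_ring (int n)"

text \<open>The carrier of \<^term>\<open>Zmod n\<close> consists of the representatives \<open>0, \<dots>, n - 1\<close>, hence
  the reduction of the evaluation point.\<close>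

definition I_ideal :: "nat \<Rightarrow> nat \<Rightarrow> (nat \<Rightarrow> int) set"
  where "I_ideal p m = {f \<in> carrier (UP (Zmod (p ^ m))).
    \<forall>k::int. eval (Zmod (p ^ m)) (Zmod (p ^ m)) id ((k * int p) mod int (p ^ m)) f
      = \<zero>\<^bsub>Zmod (p ^ m)\<^esub>}"

lemma I_ideal_is_ideal:
  assumes "p ^ m > 1"
  shows "ideal (I_ideal p m) (UP (Zmod (p ^ m)))"
proof -
  let ?n = "int (p ^ m)"
  let ?R = "Zmod (p ^ m)"
  let ?e = "\<lambda>k::int. eval ?R ?R id ((k * int p) mod ?n)"
  have n: "?n > 1" using assms by (simp flip: of_nat_power)
  interpret R: cring ?R using residues.cring n by (simp add: residues_def)
  interpret P: cring "UP ?R" by (rule UP_is_cring) (rule R.is_cring)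
  have mem: "(k * int p) mod ?n \<in> carrier ?R" for k
  proof -
    have "0 \<le> (k * int p) mod N \<and> (k * int p) mod N < N" if "N > 1" for N
      using that by simp
    from this[OF n] show ?thesis by (simp add: residue_ring_def del: of_nat_power)
  qed
  have hom: "ring_hom_ring (UP ?R) ?R (?e k)" for k
    by (intro ring_hom_ringI2 eval_id_hom R.is_cring P.ring_axioms R.ring_axioms mem)
  have "ideal (\<Inter> (range (\<lambda>k. a_kernel (UP ?R) ?R (?e k)))) (UP ?R)"
    using hom by (intro P.i_Intersect) (auto intro: ring_hom_ring.kernel_is_ideal)
  also have "\<Inter> (range (\<lambda>k. a_kernel (UP ?R) ?R (?e k))) = I_ideal p m"
    by (auto simp: I_ideal_def a_kernel_def')
  finally show ?thesis .
qed

definition I_quot :: "nat \<Rightarrow> nat \<Rightarrow> (nat \<Rightarrow> int) set ring"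
  where "I_quot p m = UP (Zmod (p ^ m)) Quot I_ideal p m"

text \<open>HOL cannot quantify over types inside a formula, so the types of the elements of the two
  summands are parameters. Non-decomposability is to be stated with these types arbitrary.\<close>

definition decomposable :: "'b itself \<Rightarrow> 'c itself \<Rightarrow> ('a, 'm) ring_scheme \<Rightarrow> bool"
  where "decomposable TB TC R \<longleftrightarrow>
    (\<exists>(A :: 'b ring) (B :: 'c ring). ring A \<and> ring B \<and>
       carrier A \<noteq> {\<zero>\<^bsub>A\<^esub>} \<and> carrier B \<noteq> {\<zero>\<^bsub>B\<^esub>} \<and> R \<simeq> RDirProd A B)"

end

theory Submission
  imports Defs
begin

text \<open>Write \<open>R\<close> for the ring of residues modulo \<open>p ^ m\<close>, \<open>P\<close> for \<open>R[x]\<close> and, for a set \<open>A\<close> of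
  points, \<open>V A\<close> for the ideal of the polynomials in \<open>P\<close> that vanish on \<open>A\<close>. The ring of
  polyfunctions is \<open>P / V R\<close>. The points of \<open>R\<close> fall into \<open>p\<close> residue classes modulo \<open>p\<close>, so
  \<open>V R\<close> is the intersection of the \<open>p\<close> ideals \<open>V (A + i)\<close>, where \<open>A\<close> consists of the multiples
  of \<open>p\<close>.

  These ideals are pairwise comaximal, because there is a polynomial function that is \<open>0\<close> on a
  given class and \<open>1\<close> on all others: take \<open>(x - i) ^ K\<close> with \<open>K\<close> large and divisible by the
  order of the unit group (\<open>separating_polynomial\<close>). The Chinese remainder theorem then splits
  \<open>P / V R\<close> into the product of the \<open>P / V (A + i)\<close>, and the substitution of \<open>x + i\<close> for \<open>x\<close>
  identifies each factor with \<open>P / V A\<close>, which is the quotient by \<open>I_ideal p m\<close>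
  (\<open>polyfun_ring_iso_RDirProd_list\<close>).

  A decomposition of \<open>P / V A\<close> would give an idempotent other than \<open>0\<close> and \<open>1\<close>. Let \<open>f\<close> represent
  an idempotent. Each value \<open>f(a)\<close> is an idempotent of the local ring \<open>R\<close>, hence \<open>0\<close> or \<open>1\<close>. As
  \<open>b - a\<close> divides \<open>f(b) - f(a)\<close> and \<open>p\<close> divides \<open>b - a\<close>, the difference of two values is never
  \<open>1\<close>, so \<open>f\<close> is constantly \<open>0\<close> or constantly \<open>1\<close> on \<open>A\<close>
  (\<open>idempotents_quotient_V_trivial\<close>).\<close>

section \<open>Direct products and idempotents\<close>

lemma RDirProd_list_cong_iso:
  fixes Rs :: "'a ring list" and Ss :: "'b ring list"
  assumes "list_all2 (\<simeq>) Rs Ss" and "\<And>R. R \<in> set Rs \<Longrightarrow> ring R"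
  shows "RDirProd_list Rs \<simeq> RDirProd_list Ss"
  using assms
proof (induction rule: list_all2_induct)
  case Nil
  show ?case
    by (auto simp: is_ring_iso_def ring_iso_def ring_hom_def bij_betw_def monoid.defs)
next
  case (Cons R Rs S Ss)
  obtain f where f: "f \<in> ring_iso R S"
    using Cons.hyps(1) by (auto simp: is_ring_iso_def)
  obtain g where g: "g \<in> ring_iso (RDirProd_list Rs) (RDirProd_list Ss)"
    using Cons.IH Cons.prems by (auto simp: is_ring_iso_def)
  show ?case
    using ring_iso_set_trans[OF ring_iso_set_trans[OF RDirProd_list_iso2 RDirProd_iso6[OF f g]]
        RDirProd_list_iso1]
    by (auto simp: is_ring_iso_def)
qed

text \<open>In a product of two rings, \<open>(1, 0)\<close> is idempotent, and it differs from \<open>(0, 0)\<close> and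
  \<open>(1, 1)\<close> when both factors are nonzero.\<close>

lemma not_decomposable_if_trivial_idempotents:
  assumes "ring Q"
    and idem: "\<And>e. e \<in> carrier Q \<Longrightarrow> e \<otimes>\<^bsub>Q\<^esub> e = e \<Longrightarrow> e = \<zero>\<^bsub>Q\<^esub> \<or> e = \<one>\<^bsub>Q\<^esub>"
  shows "\<not> decomposable TYPE('b) TYPE('c) Q"
proof
  assume "decomposable TYPE('b) TYPE('c) Q"
  then obtain A :: "'b ring" and B :: "'c ring"
    where A: "ring A" "carrier A \<noteq> {\<zero>\<^bsub>A\<^esub>}" and B: "ring B" "carrier B \<noteq> {\<zero>\<^bsub>B\<^esub>}"
      and "Q \<simeq> RDirProd A B"
    by (auto simp: decomposable_def)
  then obtain h where h: "h \<in> ring_iso Q (RDirProd A B)"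
    by (auto simp: is_ring_iso_def)
  interpret A: ring A by fact
  interpret B: ring B by fact
  interpret Q: ring Q by fact
  interpret AB: ring "RDirProd A B" by (rule RDirProd_ring) fact+
  interpret h: ring_hom_ring Q "RDirProd A B" h
    using h by (intro ring_hom_ringI2 Q.ring_axioms AB.ring_axioms) (simp add: ring_iso_def)
  have bij: "bij_betw h (carrier Q) (carrier (RDirProd A B))"
    using h by (simp add: ring_iso_def)
  have "(\<one>\<^bsub>A\<^esub>, \<zero>\<^bsub>B\<^esub>) \<in> h ` carrier Q"
    using bij by (simp add: bij_betw_def RDirProd_carrier)
  then obtain e where e: "e \<in> carrier Q" "h e = (\<one>\<^bsub>A\<^esub>, \<zero>\<^bsub>B\<^esub>)"
    by auto
  have "h (e \<otimes>\<^bsub>Q\<^esub> e) = h e"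
    using e by (simp add: RDirProd_def DirProd_def monoid.defs)
  then have "e \<otimes>\<^bsub>Q\<^esub> e = e"
    using bij e(1) by (auto simp: bij_betw_def inj_on_def)
  with idem e(1) have "e = \<zero>\<^bsub>Q\<^esub> \<or> e = \<one>\<^bsub>Q\<^esub>"
    by blast
  then have "(\<one>\<^bsub>A\<^esub>, \<zero>\<^bsub>B\<^esub>) = (\<zero>\<^bsub>A\<^esub>, \<zero>\<^bsub>B\<^esub>) \<or> (\<one>\<^bsub>A\<^esub>, \<zero>\<^bsub>B\<^esub>) = (\<one>\<^bsub>A\<^esub>, \<one>\<^bsub>B\<^esub>)"
    using e(2) h.hom_zero h.hom_one by (auto simp: RDirProd_def DirProd_def monoid.defs)
  then show False
    using A(2) B(2) A.carrier_one_zero B.carrier_one_zero by auto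
qed

section \<open>Ideals of polynomials vanishing on a set\<close>

definition vanishing_ideal :: "('a, 'm) ring_scheme \<Rightarrow> 'a set \<Rightarrow> (nat \<Rightarrow> 'a) set"
  where "vanishing_ideal R A = {f \<in> carrier (UP R). \<forall>a\<in>A. eval R R id a f = \<zero>\<^bsub>R\<^esub>}"

text \<open>The substitution of \<open>x + c\<close> for \<open>x\<close>, obtained by evaluating over the polynomial ring
  itself.\<close>

definition translate :: "('a, 'm) ring_scheme \<Rightarrow> 'a \<Rightarrow> (nat \<Rightarrow> 'a) \<Rightarrow> (nat \<Rightarrow> 'a)"
  where "translate R c = eval R (UP R) (\<lambda>r. monom (UP R) r 0)
    (monom (UP R) \<one>\<^bsub>R\<^esub> 1 \<oplus>\<^bsub>UP R\<^esub> monom (UP R) c 0)"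

context UP_cring
begin

abbreviation "ev \<equiv> eval R R id"
abbreviation "V \<equiv> vanishing_ideal R"

lemma ev_ring_hom_cring:
  assumes "a \<in> carrier R"
  shows "ring_hom_cring P R (ev a)"
  using eval_id_hom[OF R.is_cring assms]
  by (intro ring_hom_cringI P.is_cring R.is_cring) (simp add: P_def)

lemma ev_minus:
  assumes "a \<in> carrier R" "f \<in> carrier P" "g \<in> carrier P"
  shows "ev a (f \<ominus>\<^bsub>P\<^esub> g) = ev a f \<ominus> ev a g"
proof -
  interpret ring_hom_cring P R "ev a" using assms(1) by (rule ev_ring_hom_cring)
  show ?thesis using assms by (simp add: P.minus_eq R.minus_eq)
qed

lemma ev_const:
  assumes "a \<in> carrier R" "r \<in> carrier R"
  shows "ev a (monom P r 0) = r"
proof -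
  interpret UP_pre_univ_prop R R id P by unfold_locales simp
  show ?thesis using assms by (simp add: eval_const)
qed

lemma ev_X:
  assumes "a \<in> carrier R"
  shows "ev a (monom P \<one> 1) = a"
proof -
  interpret UP_pre_univ_prop R R id P by unfold_locales simp
  show ?thesis using assms by (rule eval_monom1)
qed

lemma mem_V_iff: "f \<in> V A \<longleftrightarrow> f \<in> carrier P \<and> (\<forall>a\<in>A. ev a f = \<zero>)"
  by (simp add: vanishing_ideal_def P_def)

lemma V_ideal:
  assumes "A \<subseteq> carrier R"
  shows "ideal (V A) P"
proof -
  have "ideal (a_kernel P R (ev a)) P" if "a \<in> A" for a
  proof -
    interpret ring_hom_cring P R "ev a" using assms that by (intro ev_ring_hom_cring) auto
    show ?thesis
      by (rule ring_hom_ring.kernel_is_ideal[OF ring_hom_ringI2[OF P.ring_axioms R.ring_axioms homh]])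
  qed
  then have "ideal (\<Inter> (insert (carrier P) ((\<lambda>a. a_kernel P R (ev a)) ` A))) P"
    by (intro P.i_Intersect) (auto simp: P.oneideal)
  also have "\<Inter> (insert (carrier P) ((\<lambda>a. a_kernel P R (ev a)) ` A)) = V A"
    by (auto simp: mem_V_iff a_kernel_def')
  finally show ?thesis .
qed

text \<open>Classes modulo \<^term>\<open>V A\<close> are the polynomial functions on \<open>A\<close>: this criterion reduces
  every later computation in the quotient to a comparison of values.\<close>

lemma V_coset_eq_iff:
  assumes "A \<subseteq> carrier R" "f \<in> carrier P" "g \<in> carrier P"
  shows "V A +>\<^bsub>P\<^esub> f = V A +>\<^bsub>P\<^esub> g \<longleftrightarrow> (\<forall>a\<in>A. ev a f = ev a g)"
proof -
  have "ev a f \<in> carrier R \<and> ev a g \<in> carrier R" if "a \<in> A" for a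
  proof -
    interpret ring_hom_cring P R "ev a" using assms that by (intro ev_ring_hom_cring) auto
    show ?thesis using assms by simp
  qed
  with assms have "f \<ominus>\<^bsub>P\<^esub> g \<in> V A \<longleftrightarrow> (\<forall>a\<in>A. ev a f = ev a g)"
    by (auto simp: mem_V_iff ev_minus subset_iff)
  then show ?thesis
    using P.quotient_eq_iff_same_a_r_cos[OF V_ideal[OF assms(1)] assms(2,3)] by simp
qed

lemma carrier_quotient_V: "carrier (P Quot V A) = (\<lambda>f. V A +>\<^bsub>P\<^esub> f) ` carrier P"
  by (auto simp: FactRing_def A_RCOSETS_def')

lemma zero_quotient_V:
  assumes "A \<subseteq> carrier R"
  shows "\<zero>\<^bsub>P Quot V A\<^esub> = V A +>\<^bsub>P\<^esub> \<zero>\<^bsub>P\<^esub>"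
proof -
  interpret ring_hom_ring P "P Quot V A" "(+>\<^bsub>P\<^esub>) (V A)"
    using V_ideal[OF assms] by (rule ideal.rcos_ring_hom_ring)
  show ?thesis by simp
qed

lemma one_quotient_V: "\<one>\<^bsub>P Quot V A\<^esub> = V A +>\<^bsub>P\<^esub> \<one>\<^bsub>P\<^esub>"
  by (simp add: FactRing_def)

text \<open>Sending a polynomial to its function is a surjective homomorphism onto the ring of
  polyfunctions, and its kernel is the ideal of the polynomials vanishing everywhere.\<close>

lemma quotient_V_carrier_iso_polyfun_ring:
  "P Quot V (carrier R) \<simeq> polyfun_ring R"
proof -
  let ?h = "\<lambda>f. \<lambda>a\<in>carrier R. ev a f"
  have hom: "ev a \<in> ring_hom P R" if "a \<in> carrier R" for a
    using eval_id_hom[OF R.is_cring that] by (simp add: P_def)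
  have img: "?h ` carrier P = carrier (polyfun_ring R)"
  proof
    show "?h ` carrier P \<subseteq> carrier (polyfun_ring R)"
      using ring_hom_closed[OF hom] by (auto simp: polyfun_ring_def P_def)
    show "carrier (polyfun_ring R) \<subseteq> ?h ` carrier P"
    proof
      fix F assume F: "F \<in> carrier (polyfun_ring R)"
      then obtain q where q: "q \<in> carrier P" "\<And>x. x \<in> carrier R \<Longrightarrow> F x = ev x q"
        by (auto simp: polyfun_ring_def P_def)
      have "F = ?h q"
        using F q(2) by (intro extensionalityI[of _ "carrier R"]) (auto simp: polyfun_ring_def PiE_def)
      with q(1) show "F \<in> ?h ` carrier P" by blast
    qed
  qed
  have "?h \<in> ring_hom P (polyfun_ring R)"
  proof (rule ring_hom_memI)
    fix f assume "f \<in> carrier P"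
    then show "?h f \<in> carrier (polyfun_ring R)" using img by blast
  qed (auto simp: polyfun_ring_def ring_hom_mult[OF hom] ring_hom_add[OF hom] ring_hom_one[OF hom])
  then interpret h: ring_hom_ring P "polyfun_ring R" ?h
    by (intro ring_hom_ringI2 P.ring_axioms cring.axioms(1) polyfun_ring_is_cring R.is_cring)
  have ker: "?h f = \<zero>\<^bsub>polyfun_ring R\<^esub> \<longleftrightarrow> (\<forall>a\<in>carrier R. ev a f = \<zero>)" for f
    by (auto simp: polyfun_ring_def fun_eq_iff)
  have "a_kernel P (polyfun_ring R) ?h = V (carrier R)"
    by (intro Set.set_eqI) (simp only: a_kernel_def' mem_V_iff mem_Collect_eq ker)
  with h.FactRing_iso[OF img] show ?thesis by simp
qed

lemma translate_ring_hom:
  assumes "c \<in> carrier R"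
  shows "translate R c \<in> ring_hom P P"
proof -
  interpret UP_pre_univ_prop R P "\<lambda>r. monom P r 0" P
    by unfold_locales (rule const_ring_hom)
  show ?thesis
    unfolding translate_def P_def[symmetric] using assms by (intro eval_ring_hom) simp
qed

text \<open>Both sides are homomorphisms in \<open>f\<close> that fix constants and send \<open>x\<close> to \<open>a + c\<close>, so
  they agree by the universal property of the polynomial ring.\<close>

lemma ev_translate:
  assumes "c \<in> carrier R" "a \<in> carrier R" "f \<in> carrier P"
  shows "ev a (translate R c f) = ev (a \<oplus> c) f"
proof -
  interpret C: UP_pre_univ_prop R P "\<lambda>r. monom P r 0" P
    by unfold_locales (rule const_ring_hom)
  interpret E: UP_pre_univ_prop R R id P by unfold_locales simp
  interpret ea: ring_hom_cring P R "ev a" using assms(2) by (rule ev_ring_hom_cring)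
  let ?s = "monom P \<one> 1 \<oplus>\<^bsub>P\<^esub> monom P c 0"
  have tr: "translate R c = eval R P (\<lambda>r. monom P r 0) ?s"
    by (simp add: translate_def P_def)
  have s: "?s \<in> carrier P" using assms by simp
  have "(ev a \<circ> translate R c) f = ev (a \<oplus> c) f"
  proof (rule E.UP_hom_unique[where s = "a \<oplus> c" and Phi = "ev a \<circ> translate R c" and Psi = "ev (a \<oplus> c)"])
    have "ev a \<circ> translate R c \<in> ring_hom P R"
      using ring_hom_trans[OF translate_ring_hom[OF assms(1)] ea.homh] .
    then show "ring_hom_cring P R (ev a \<circ> translate R c)"
      by (intro ring_hom_cringI P.is_cring R.is_cring)
    show "(ev a \<circ> translate R c) (monom P \<one> (Suc 0)) = a \<oplus> c"
      using C.eval_monom1[OF s] assms by (simp add: tr ev_const ev_X[simplified])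
    show "(ev a \<circ> translate R c) (monom P r 0) = id r" if "r \<in> carrier R" for r
      using C.eval_const[OF s that] assms that by (simp add: tr ev_const)
    show "ring_hom_cring P R (ev (a \<oplus> c))"
      using assms by (intro ev_ring_hom_cring) simp
    show "ev (a \<oplus> c) (monom P \<one> (Suc 0)) = a \<oplus> c"
      using ev_X[of "a \<oplus> c"] assms by simp
    show "ev (a \<oplus> c) (monom P r 0) = id r" if "r \<in> carrier R" for r
      using assms that by (simp add: ev_const)
  qed (use assms in auto)
  then show ?thesis by simp
qed

text \<open>The substitution of \<open>x + c\<close> for \<open>x\<close>, followed by the projection modulo \<^term>\<open>V A\<close>, has
  kernel \<^term>\<open>V ((\<lambda>a. a \<oplus> c) ` A)\<close>. It is surjective because substituting \<open>x - c\<close> first gives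
  back the same values on \<open>A\<close>.\<close>

lemma quotient_V_translate_iso:
  assumes A: "A \<subseteq> carrier R" and c: "c \<in> carrier R"
  shows "P Quot V ((\<lambda>a. a \<oplus> c) ` A) \<simeq> P Quot V A"
proof -
  let ?h = "(+>\<^bsub>P\<^esub>) (V A) \<circ> translate R c"
  have t: "translate R d f \<in> carrier P" if "d \<in> carrier R" "f \<in> carrier P" for d f
    using ring_hom_closed[OF translate_ring_hom] that by blast
  have "?h \<in> ring_hom P (P Quot V A)"
    by (rule ring_hom_trans[OF translate_ring_hom[OF c] ideal.rcos_ring_hom[OF V_ideal[OF A]]])
  then interpret h: ring_hom_ring P "P Quot V A" ?h
    by (intro ring_hom_ringI2 P.ring_axioms ideal.quotient_is_ring V_ideal A)
  have "V A +>\<^bsub>P\<^esub> f \<in> ?h ` carrier P" if f: "f \<in> carrier P" for f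
  proof
    have "ev a (translate R c (translate R (\<ominus> c) f)) = ev a f" if "a \<in> carrier R" for a
      using f c that t by (simp add: ev_translate R.a_assoc R.r_neg)
    then show "V A +>\<^bsub>P\<^esub> f = ?h (translate R (\<ominus> c) f)"
      using A c f t by (subst comp_def, subst V_coset_eq_iff) (auto simp: subset_iff)
  qed (use c f t in simp)
  then have img: "?h ` carrier P = carrier (P Quot V A)"
    using h.hom_closed by (auto simp: carrier_quotient_V simp del: comp_apply)
  have ker: "?h f = \<zero>\<^bsub>P Quot V A\<^esub> \<longleftrightarrow> (\<forall>a\<in>A. ev (a \<oplus> c) f = \<zero>)" if f: "f \<in> carrier P" for f
  proof -
    have "?h f = \<zero>\<^bsub>P Quot V A\<^esub> \<longleftrightarrow> (\<forall>a\<in>A. ev a (translate R c f) = ev a \<zero>\<^bsub>P\<^esub>)"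
      using A c f t by (simp add: zero_quotient_V V_coset_eq_iff)
    also have "\<dots> \<longleftrightarrow> (\<forall>a\<in>A. ev (a \<oplus> c) f = \<zero>)"
    proof (intro ball_cong refl)
      fix a assume "a \<in> A"
      then have a: "a \<in> carrier R" using A by auto
      interpret ring_hom_cring P R "ev a" using a by (rule ev_ring_hom_cring)
      show "ev a (translate R c f) = ev a \<zero>\<^bsub>P\<^esub> \<longleftrightarrow> ev (a \<oplus> c) f = \<zero>"
        using a c f by (simp add: ev_translate)
    qed
    finally show ?thesis .
  qed
  have "a_kernel P (P Quot V A) ?h = V ((\<lambda>a. a \<oplus> c) ` A)"
    by (intro Set.set_eqI) (simp only: a_kernel_def' mem_V_iff mem_Collect_eq ball_simps ker cong: conj_cong)
  with h.FactRing_iso[OF img] show ?thesis by simp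
qed

text \<open>In \<open>1 = f + (1 - f)\<close> the first summand lies in \<^term>\<open>V A\<close> and the second in \<^term>\<open>V B\<close>.\<close>

lemma V_comaximal:
  assumes A: "A \<subseteq> carrier R" and B: "B \<subseteq> carrier R" and f: "f \<in> carrier P"
    and "\<And>a. a \<in> A \<Longrightarrow> ev a f = \<zero>" and "\<And>b. b \<in> B \<Longrightarrow> ev b f = \<one>"
  shows "V A <+>\<^bsub>P\<^esub> V B = carrier P"
proof -
  interpret ideal "V A <+>\<^bsub>P\<^esub> V B" P
    by (intro P.add_ideals V_ideal A B)
  have "ev b \<one>\<^bsub>P\<^esub> = \<one>" if "b \<in> B" for b
  proof -
    interpret ring_hom_cring P R "ev b" using B that by (intro ev_ring_hom_cring) auto
    show ?thesis by simp
  qed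
  then have "\<one>\<^bsub>P\<^esub> \<ominus>\<^bsub>P\<^esub> f \<in> V B"
    using assms by (auto simp: mem_V_iff ev_minus subset_iff R.minus_eq R.r_neg)
  moreover have "f \<in> V A" using assms by (simp add: mem_V_iff)
  moreover have "\<one>\<^bsub>P\<^esub> = f \<oplus>\<^bsub>P\<^esub> (\<one>\<^bsub>P\<^esub> \<ominus>\<^bsub>P\<^esub> f)"
    using f by (simp add: P.minus_eq P.a_lcomm[of f] P.r_neg)
  ultimately have "\<one>\<^bsub>P\<^esub> \<in> V A <+>\<^bsub>P\<^esub> V B"
    unfolding set_add_def' by blast
  then show ?thesis by (rule one_imp_carrier)
qed

text \<open>The quotient is the value at \<open>b\<close> of the polynomial \<open>q\<close> in the division
  \<open>f = (x - a) q + f(a)\<close>.\<close>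

lemma ev_diff_multiple:
  assumes "carrier R \<noteq> {\<zero>}" "a \<in> carrier R" "b \<in> carrier R" "f \<in> carrier P"
  shows "\<exists>c\<in>carrier R. ev b f \<ominus> ev a f = (b \<ominus> a) \<otimes> c"
proof -
  interpret eb: ring_hom_cring P R "ev b" using assms(3) by (rule ev_ring_hom_cring)
  interpret ea: ring_hom_cring P R "ev a" using assms(2) by (rule ev_ring_hom_cring)
  obtain q where q: "q \<in> carrier P"
    and f: "f = (monom P \<one> 1 \<ominus>\<^bsub>P\<^esub> monom P a 0) \<otimes>\<^bsub>P\<^esub> q \<oplus>\<^bsub>P\<^esub> monom P (ev a f) 0"
    using remainder_theorem[OF assms(4,2,1)] by blast
  have g: "monom P \<one> 1 \<ominus>\<^bsub>P\<^esub> monom P a 0 \<in> carrier P"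
    using assms by simp
  have "ev b f = ev b ((monom P \<one> 1 \<ominus>\<^bsub>P\<^esub> monom P a 0) \<otimes>\<^bsub>P\<^esub> q \<oplus>\<^bsub>P\<^esub> monom P (ev a f) 0)"
    using f by simp
  also have "\<dots> = ev b (monom P \<one> 1 \<ominus>\<^bsub>P\<^esub> monom P a 0) \<otimes> ev b q \<oplus> ev a f"
    using q g assms by (simp add: ev_const)
  also have "ev b (monom P \<one> 1 \<ominus>\<^bsub>P\<^esub> monom P a 0) = b \<ominus> a"
    using assms by (subst ev_minus) (simp_all add: ev_const ev_X[simplified])
  finally have e: "ev b f = (b \<ominus> a) \<otimes> ev b q \<oplus> ev a f" .
  have "ev b f \<ominus> ev a f = (b \<ominus> a) \<otimes> ev b q"
    unfolding e using assms q by (simp add: R.minus_eq R.a_assoc R.r_neg)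
  then show ?thesis using q by auto
qed

text \<open>An idempotent takes the values \<open>0\<close> and \<open>1\<close> only, and it
  cannot take both of them, say at \<open>a\<close> and \<open>b\<close>, since then \<open>1 = f(b) - f(a)\<close> would be a multiple
  of the nonunit \<open>b - a\<close>.\<close>

lemma idempotents_quotient_V_trivial:
  assumes A: "A \<subseteq> carrier R" and "\<one> \<noteq> \<zero>"
    and idem: "\<And>e. e \<in> carrier R \<Longrightarrow> e \<otimes> e = e \<Longrightarrow> e = \<zero> \<or> e = \<one>"
    and nonunit: "\<And>a b. a \<in> A \<Longrightarrow> b \<in> A \<Longrightarrow> a \<ominus> b \<notin> Units R"
    and x: "x \<in> carrier (P Quot V A)" "x \<otimes>\<^bsub>P Quot V A\<^esub> x = x"
  shows "x = \<zero>\<^bsub>P Quot V A\<^esub> \<or> x = \<one>\<^bsub>P Quot V A\<^esub>"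
proof -
  obtain f where f: "f \<in> carrier P" and xf: "x = V A +>\<^bsub>P\<^esub> f"
    using x(1) by (auto simp: carrier_quotient_V)
  have "V A +>\<^bsub>P\<^esub> (f \<otimes>\<^bsub>P\<^esub> f) = V A +>\<^bsub>P\<^esub> f"
    using x(2) f xf ring_hom_mult[OF ideal.rcos_ring_hom[OF V_ideal[OF A]] f f] by simp
  then have ff: "\<forall>a\<in>A. ev a (f \<otimes>\<^bsub>P\<^esub> f) = ev a f"
    using A f by (simp add: V_coset_eq_iff)
  have val: "ev a f = \<zero> \<or> ev a f = \<one>" "ev a \<zero>\<^bsub>P\<^esub> = \<zero>" "ev a \<one>\<^bsub>P\<^esub> = \<one>" if "a \<in> A" for a
  proof -
    interpret ring_hom_cring P R "ev a" using A that by (intro ev_ring_hom_cring) auto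
    show "ev a f = \<zero> \<or> ev a f = \<one>" using f ff that by (intro idem) auto
    show "ev a \<zero>\<^bsub>P\<^esub> = \<zero>" "ev a \<one>\<^bsub>P\<^esub> = \<one>" by simp_all
  qed
  have "\<not> (ev a f = \<zero> \<and> ev b f = \<one>)" if a: "a \<in> A" and b: "b \<in> A" for a b
  proof
    assume ab: "ev a f = \<zero> \<and> ev b f = \<one>"
    have "carrier R \<noteq> {\<zero>}" using \<open>\<one> \<noteq> \<zero>\<close> R.one_closed by blast
    then obtain c where c: "c \<in> carrier R" "ev b f \<ominus> ev a f = (b \<ominus> a) \<otimes> c"
      using ev_diff_multiple[of a b f] A a b f by auto
    then have "(b \<ominus> a) \<otimes> c = \<one>" using ab by (simp add: R.minus_eq)
    moreover have "b \<ominus> a \<in> carrier R" using A a b by auto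
    ultimately have "b \<ominus> a \<in> Units R"
      using c(1) by (auto simp: Units_def R.m_comm)
    with nonunit[OF b a] show False by contradiction
  qed
  with val(1) have "(\<forall>a\<in>A. ev a f = \<zero>) \<or> (\<forall>a\<in>A. ev a f = \<one>)"
    by blast
  then show ?thesis
    using A f val(2,3) by (simp add: xf zero_quotient_V one_quotient_V V_coset_eq_iff)
qed

text \<open>If translates of \<open>A\<close> cover the ring and can be separated pairwise by polynomial functions,
  then the Chinese remainder theorem applies to their vanishing ideals, whose intersection
  consists of the polynomials that vanish everywhere; all factors are isomorphic by
  translation.\<close>

theorem polyfun_ring_iso_RDirProd_list:
  assumes A: "A \<subseteq> carrier R" and c: "\<And>i. i \<le> n \<Longrightarrow> c i \<in> carrier R"
    and cover: "(\<Union>i\<le>n. (\<lambda>a. a \<oplus> c i) ` A) = carrier R"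
    and sep: "\<And>i j. i \<le> n \<Longrightarrow> j \<le> n \<Longrightarrow> i \<noteq> j \<Longrightarrow>
      \<exists>f\<in>carrier P. \<forall>a\<in>A. ev (a \<oplus> c i) f = \<zero> \<and> ev (a \<oplus> c j) f = \<one>"
  shows "polyfun_ring R \<simeq> RDirProd_list (replicate (Suc n) (P Quot V A))"
proof -
  let ?A = "\<lambda>i. (\<lambda>a. a \<oplus> c i) ` A"
  have sub: "?A i \<subseteq> carrier R" if "i \<le> n" for i
    using A c[OF that] by auto
  have ideals: "ideal (V (?A i)) P" if "i \<le> n" for i
    using sub[OF that] by (rule V_ideal)
  have comax: "V (?A i) <+>\<^bsub>P\<^esub> V (?A j) = carrier P" if ij: "i \<le> n" "j \<le> n" "i \<noteq> j" for i j
  proof -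
    obtain f where "f \<in> carrier P" "\<forall>a\<in>A. ev (a \<oplus> c i) f = \<zero> \<and> ev (a \<oplus> c j) f = \<one>"
      using sep[OF ij] by blast
    then show ?thesis
      by (intro V_comaximal[of _ _ f] sub ij) auto
  qed
  have "(\<Inter>i\<le>n. V (?A i)) = V (\<Union>i\<le>n. ?A i)"
    by (auto simp: mem_V_iff)
  then have inter: "(\<Inter>i\<le>n. V (?A i)) = V (carrier R)"
    by (simp only: cover)
  have "polyfun_ring R \<simeq> P Quot V (carrier R)"
    by (rule ring_iso_sym[OF ideal.quotient_is_ring[OF V_ideal[OF subset_refl]]
        quotient_V_carrier_iso_polyfun_ring])
  also have "\<dots> \<simeq> RDirProd_list (map (\<lambda>i. P Quot V (?A i)) [0..<Suc n])"
    unfolding inter[symmetric] by (intro P.chinese_remainder ideals comax)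
  also (ring_iso_trans) have "\<dots> \<simeq> RDirProd_list (replicate (Suc n) (P Quot V A))"
  proof (rule RDirProd_list_cong_iso)
    show "list_all2 (\<simeq>) (map (\<lambda>i. P Quot V (?A i)) [0..<Suc n]) (replicate (Suc n) (P Quot V A))"
      using quotient_V_translate_iso[OF A c]
      by (auto simp: list_all2_conv_all_nth simp del: upt_Suc replicate_Suc)
    show "ring Q" if "Q \<in> set (map (\<lambda>i. P Quot V (?A i)) [0..<Suc n])" for Q
      using that ideal.quotient_is_ring[OF ideals] by auto
  qed
  finally (ring_iso_trans) show ?thesis .
qed

end

section \<open>Residues modulo a prime power\<close>

locale prime_power_residues = residues N R for N :: int and R (structure) +
  fixes p m :: nat
  assumes p_prime: "prime p" and m_pos: "m \<ge> 1" and N_eq: "N = int p ^ m"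
begin

sublocale UP_cring R "UP R" by unfold_locales

definition p_multiples :: "int set"
  where "p_multiples = {x \<in> carrier R. int p dvd x}"

lemma res_minus_eq: "x \<ominus> y = (x - y) mod N"
  by (simp add: a_minus_def res_neg_eq res_add_eq mod_simps)

lemma p_dvd_N: "int p dvd N"
  using m_pos by (simp add: N_eq dvd_power)

lemma I_ideal_eq: "I_ideal p m = V p_multiples"
proof -
  have R: "residue_ring N = R" and N: "int (p ^ m) = N"
    by (simp_all add: R_m_def N_eq)
  have "p_multiples = range (\<lambda>k. (k * int p) mod N)"
  proof (intro equalityI subsetI)
    fix x assume x: "x \<in> p_multiples"
    then have "x mod N = x" by (auto simp: p_multiples_def res_carrier_eq)
    moreover obtain k where "x = int p * k"
      using x by (auto simp: p_multiples_def)
    ultimately have "x = (k * int p) mod N" by (simp add: mult.commute)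
    then show "x \<in> range (\<lambda>k. (k * int p) mod N)" by (rule range_eqI)
  next
    fix x assume "x \<in> range (\<lambda>k. (k * int p) mod N)"
    then show "x \<in> p_multiples"
      using p_dvd_N by (auto simp: p_multiples_def dvd_mod)
  qed
  then show ?thesis
    by (auto simp: I_ideal_def vanishing_ideal_def R N simp del: of_nat_power)
qed

text \<open>The prime \<open>p\<close> divides at most one of the coprime factors \<open>e\<close> and \<open>e - 1\<close>, so the prime power
  \<^term>\<open>N\<close>, which divides their product, divides one of them.\<close>

lemma idempotent_trivial:
  assumes "e \<in> carrier R" "e \<otimes> e = e"
  shows "e = \<zero> \<or> e = \<one>"
proof -
  have e: "0 \<le> e" "e < N" using assms(1) by (auto simp: res_carrier_eq)
  have "(e * e) mod N = e mod N"
    using assms(2) e by (simp add: res_mult_eq)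
  then have dvd: "N dvd e * (e - 1)"
    by (simp add: mod_eq_dvd_iff algebra_simps)
  have pr: "prime (int p)" using p_prime by simp
  show ?thesis
  proof (cases "int p dvd e")
    case True
    have "\<not> int p dvd e - 1"
    proof
      assume "int p dvd e - 1"
      with True have "int p dvd e - (e - 1)" by (rule dvd_diff)
      then show False using pr by (simp add: prime_int_iff)
    qed
    then have "coprime N (e - 1)"
      using pr by (auto simp: N_eq prime_imp_coprime)
    then have "N dvd e" using dvd by (simp add: coprime_dvd_mult_left_iff)
    then show ?thesis using e by (auto simp: res_zero_eq dest: zdvd_imp_le)
  next
    case False
    then have "coprime N e"
      using pr by (auto simp: N_eq prime_imp_coprime)
    then have "N dvd e - 1" using dvd by (simp add: coprime_dvd_mult_right_iff)
    moreover have "e \<noteq> 0" using False by auto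
    ultimately show ?thesis using e by (auto simp: res_one_eq dest: zdvd_imp_le)
  qed
qed

lemma p_multiples_diff_nonunit:
  assumes "a \<in> p_multiples" "b \<in> p_multiples"
  shows "a \<ominus> b \<notin> Units R"
proof
  assume "a \<ominus> b \<in> Units R"
  then have "coprime (a \<ominus> b) N" by (simp add: res_units_eq)
  moreover have "int p dvd a \<ominus> b"
    using assms p_dvd_N
    by (auto simp: p_multiples_def res_minus_eq dvd_mod)
  ultimately have "is_unit (int p)"
    using p_dvd_N coprime_common_divisor by blast
  moreover have "prime (int p)" using p_prime by simp
  ultimately show False using not_prime_unit by blast
qed

text \<open>A suitable power of \<open>x - c\<close> works. On the class of \<open>c\<close> the value of \<open>x - c\<close> is divisible by
  \<open>p\<close>, so its \<open>m\<close>-th power vanishes; on the other classes it is a unit, so Euler's theorem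
  applies.\<close>

lemma separating_polynomial:
  assumes c: "c \<in> carrier R"
  shows "\<exists>f\<in>carrier (UP R). \<forall>x\<in>carrier R. ev x f = (if [x = c] (mod int p) then \<zero> else \<one>)"
proof
  \<comment> \<open>at least \<open>m\<close>, to annihilate the multiples of \<open>p\<close>, and divisible by the order of the unit group\<close>
  let ?K = "m * totient (nat N)"
  let ?g = "monom (UP R) \<one> 1 \<ominus>\<^bsub>UP R\<^esub> monom (UP R) c 0"
  show "?g [^]\<^bsub>UP R\<^esub> ?K \<in> carrier (UP R)" using c by simp
  show "\<forall>x\<in>carrier R. ev x (?g [^]\<^bsub>UP R\<^esub> ?K) = (if [x = c] (mod int p) then \<zero> else \<one>)"
  proof
    fix x assume x: "x \<in> carrier R"
    interpret ring_hom_cring "UP R" R "ev x" using x by (rule ev_ring_hom_cring)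
    have "ev x ?g = x \<ominus> c"
      using c x by (subst ev_minus) (simp_all add: ev_const ev_X[simplified])
    also have "\<dots> = (x - c) mod N"
      by (rule res_minus_eq)
    finally have val: "ev x (?g [^]\<^bsub>UP R\<^esub> ?K) = (x - c) ^ ?K mod N"
      using c by (simp add: pow_cong)
    show "ev x (?g [^]\<^bsub>UP R\<^esub> ?K) = (if [x = c] (mod int p) then \<zero> else \<one>)"
    proof (cases "[x = c] (mod int p)")
      case True
      have "1 \<le> totient (nat N)" using m_gt_one by (simp add: Suc_le_eq)
      then have "m \<le> ?K" using mult_le_mono2[of 1 _ m] by (simp only: mult_1_right)
      have "int p dvd x - c" using True by (simp add: cong_iff_dvd_diff)
      then have "N dvd (x - c) ^ ?K"
        using \<open>m \<le> ?K\<close> by (metis N_eq dvd_power_same le_imp_power_dvd dvd_trans)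
      then show ?thesis using True val by (simp add: res_zero_eq)
    next
      case False
      then have "\<not> int p dvd x - c" by (simp add: cong_iff_dvd_diff)
      then have "coprime (x - c) N"
        using p_prime prime_imp_coprime[of "int p" "x - c"] by (simp add: N_eq coprime_commute)
      then have "[(x - c) ^ totient (nat N) = 1] (mod N)"
        by (rule euler_theorem)
      then have "[((x - c) ^ totient (nat N)) ^ m = 1 ^ m] (mod N)"
        by (rule cong_pow)
      then have "[(x - c) ^ ?K = 1] (mod N)"
        by (simp add: power_mult[symmetric] mult.commute)
      then show ?thesis using False val m_gt_one by (simp add: res_one_eq cong_def)
    qed
  qed
qed

text \<open>As \<open>p\<close> divides \<^term>\<open>N\<close>, the reduction modulo \<^term>\<open>N\<close> in the addition of \<^term>\<open>R\<close> does not
  change residue classes modulo \<open>p\<close>.\<close>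

lemma p_multiples_translate:
  assumes "c \<in> carrier R"
  shows "(\<lambda>a. a \<oplus> c) ` p_multiples = {x \<in> carrier R. [x = c] (mod int p)}"
proof (intro equalityI subsetI)
  fix x assume "x \<in> (\<lambda>a. a \<oplus> c) ` p_multiples"
  then obtain a where a: "a \<in> carrier R" "int p dvd a" and x: "x = a \<oplus> c"
    by (auto simp: p_multiples_def)
  have "(a + c) mod N mod int p = (a + c) mod int p"
    using p_dvd_N by (rule mod_mod_cancel)
  also have "\<dots> = c mod int p" using a(2) by (metis add.commute dvd_imp_mod_0 mod_add_eq add_0_right mod_mod_trivial)
  finally show "x \<in> {x \<in> carrier R. [x = c] (mod int p)}"
    using a x assms by (simp add: res_add_eq cong_def)
next
  fix x assume "x \<in> {x \<in> carrier R. [x = c] (mod int p)}"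
  then have x: "x \<in> carrier R" and "int p dvd x - c"
    by (auto simp: cong_iff_dvd_diff)
  then have "x \<ominus> c \<in> p_multiples"
    using assms p_dvd_N by (auto simp: p_multiples_def res_minus_eq dvd_mod)
  moreover have "x = (x \<ominus> c) \<oplus> c"
    using x by (simp add: res_minus_eq res_add_eq res_carrier_eq mod_simps)
  ultimately show "x \<in> (\<lambda>a. a \<oplus> c) ` p_multiples" by blast
qed

lemma polyfun_ring_iso:
  "polyfun_ring R \<simeq> RDirProd_list (replicate p (UP R Quot V p_multiples))"
proof -
  obtain n where n: "p = Suc n"
    using p_prime by (metis not_prime_0 old.nat.exhaust)
  have le: "int p \<le> N" using p_dvd_N m_gt_one by (simp add: zdvd_imp_le)
  have c: "int i \<in> carrier R" if "i \<le> n" for i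
    using that n le by (simp add: res_carrier_eq)
  have sub: "p_multiples \<subseteq> carrier R" by (auto simp: p_multiples_def)
  have mem: "(a \<oplus> int i) \<in> carrier R \<and> [a \<oplus> int i = int i] (mod int p)"
    if "a \<in> p_multiples" "i \<le> n" for a i
    using p_multiples_translate[OF c[OF that(2)]] that(1) by blast
  have "polyfun_ring R \<simeq> RDirProd_list (replicate (Suc n) (UP R Quot V p_multiples))"
  \<comment> \<open>the offsets \<open>0, \<dots>, p - 1\<close> represent the residue classes modulo \<open>p\<close>\<close>
  proof (rule polyfun_ring_iso_RDirProd_list[where c = int])
    have "x \<in> (\<Union>i\<le>n. (\<lambda>a. a \<oplus> int i) ` p_multiples)" if x: "x \<in> carrier R" for x
    proof
      let ?i = "nat (x mod int p)"
      have i: "int ?i = x mod int p" using n by simp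
      have "x mod int p < int p" using n by simp
      then have "?i < p" using i by linarith
      then have le: "?i \<le> n" using n by simp
      then show "?i \<in> {..n}" by simp
      have "[x = int ?i] (mod int p)" by (simp only: i cong_def mod_mod_trivial)
      then show "x \<in> (\<lambda>a. a \<oplus> int ?i) ` p_multiples"
        using p_multiples_translate[OF c[OF le]] x by blast
    qed
    then show "(\<Union>i\<le>n. (\<lambda>a. a \<oplus> int i) ` p_multiples) = carrier R"
      using mem by blast
    fix i j assume ij: "i \<le> n" "j \<le> n" "i \<noteq> j"
    obtain f where f: "f \<in> carrier (UP R)"
      "\<forall>x\<in>carrier R. ev x f = (if [x = int i] (mod int p) then \<zero> else \<one>)"
      using separating_polynomial[OF c[OF ij(1)]] by blast
    have "\<not> [x = int i] (mod int p)" if "[x = int j] (mod int p)" for x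
      using that ij n by (auto simp: cong_def)
    with f mem ij
    show "\<exists>f\<in>carrier (UP R). \<forall>a\<in>p_multiples. ev (a \<oplus> int i) f = \<zero> \<and> ev (a \<oplus> int j) f = \<one>"
      by (intro bexI[of _ f]) auto
  qed (use sub c in auto)
  then show ?thesis by (simp only: n)
qed

end

theorem theorem18:
  fixes p m :: nat
  assumes "prime p" and "m \<ge> 1"
  shows "polyfun_ring (Zmod (p ^ m)) \<simeq> RDirProd_list (replicate p (I_quot p m)) \<and>
    \<not> decomposable TYPE('b) TYPE('c) (I_quot p m)"
proof -
  have gt: "p ^ m > 1"
    using one_less_power[OF prime_gt_1_nat[OF assms(1)]] assms(2) by simp
  interpret prime_power_residues "int (p ^ m)" "Zmod (p ^ m)" p m
  proof unfold_locales
    have "int 1 < int (p ^ m)" using gt by (simp only: of_nat_less_iff)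
    then show "int (p ^ m) > 1" by (simp only: of_nat_1)
  qed (use assms in simp_all)
  have Q: "I_quot p m = UP (Zmod (p ^ m)) Quot V p_multiples"
    by (simp only: I_quot_def I_ideal_eq)
  have sub: "p_multiples \<subseteq> carrier (Zmod (p ^ m))" unfolding p_multiples_def by blast
  have "\<not> decomposable TYPE('b) TYPE('c) (I_quot p m)"
    unfolding Q
  proof (rule not_decomposable_if_trivial_idempotents)
    show "ring (UP (Zmod (p ^ m)) Quot V p_multiples)"
      by (rule ideal.quotient_is_ring[OF V_ideal[OF sub]])
    show "x = \<zero>\<^bsub>UP (Zmod (p ^ m)) Quot V p_multiples\<^esub> \<or> x = \<one>\<^bsub>UP (Zmod (p ^ m)) Quot V p_multiples\<^esub>"
      if "x \<in> carrier (UP (Zmod (p ^ m)) Quot V p_multiples)"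
        "x \<otimes>\<^bsub>UP (Zmod (p ^ m)) Quot V p_multiples\<^esub> x = x" for x
    proof (rule idempotents_quotient_V_trivial[OF sub _ idempotent_trivial p_multiples_diff_nonunit that])
      show "\<one>\<^bsub>Zmod (p ^ m)\<^esub> \<noteq> \<zero>\<^bsub>Zmod (p ^ m)\<^esub>" by (simp add: residue_ring_def)
    qed
  qed
  with polyfun_ring_iso show ?thesis unfolding Q by blast
qed

end
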